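(* Let $B_1,B_2\in[0,1]^{K\times K}$ be (symmetric) connectivity matrices that are $(\theta,\eta)$-friendly with $\theta<\frac{1}{4\sqrt K}$, and with eigenvalue decompositions $B_r=Q_r\Lambda Q_r^\top$, $r=1,2$. Assume moreover that $B_2=P^*B_1P^{*\top}$ for some permutation matrix $P^*\in\Pi_K$, and let $S^*$ be a diagonal sign matrix such that $Q_2=P^*Q_1S^*$. For $r=1,2$, let $\widehat B_r$ be an estimate of $B_r$ satisfying $$\|B_r-P_r\widehat B_rP_r^\top\|_F\le\frac{\theta\eta}{2\sqrt2\,K}$$ for some permutation matrix $P_r\in\Pi_K$. Let $\widehat Q_1,\widehat Q_2,\widehat S$ be as produced by the spectral matching algorithm applied to $(\widehat B_1,\widehat B_2)$, and let $$S_r=\operatorname*{argmin}_{S\in\Psi_K}\|Q_r-P_r\widehat Q_rS\|_F,\qquad r=1,2.$$ Then the following holds: (a) (Sign recovery) $\widehat S=\widetilde S:=S_1S^*S_2$. (b) (Permutation recovery) $\operatorname{LAP}(\widehat Q_1\widetilde S\widehat Q_2^\top)=\{\widetilde P\}$, where $\widetilde P:=P_2^\top P^*P_1$ (so that the permutation matrix output by the algorithm is this $\widetilde P$), and $$\|\widehat B_2-\widetilde P\widehat B_1\widetilde P^\top\|_F\le\sum_{r=1}^2\|B_r-P_r\widehat B_rP_r^\top\|_F .$$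
   Context: $\Pi_K$ is the set of $K\times K$ permutation matrices; $\Psi_K$ is the set of $K\times K$ diagonal sign matrices (diagonal entries in $\{-1,1\}$); $\mathbf 1$ is the all-ones vector in $\mathbb R^K$; $\|\cdot\|_F$ is the Frobenius norm. Friendly: a weighted adjacency matrix $B\in[0,1]^{K\times K}$ of an undirected graph on $[K]$, with eigenvalue decomposition (EVD) $B=\sum_{k=1}^K\lambda_kq_kq_k^\top$, is $(\theta,\eta)$-friendly (with $\theta,\eta>0$) if $|\lambda_k-\lambda_\ell|>\eta$ for all $k\ne\ell$ and $|q_k^\top\mathbf 1|>\theta$ for all $k\in[K]$. For matrices $B_r=Q_r\Lambda Q_r^\top$ with a common $\Lambda$ having distinct diagonal entries, $B_2=P^*B_1P^{*\top}$ holds if and only if a diagonal sign matrix $S^*$ with $Q_2=P^*Q_1S^*$ exists. LAP: for a $K\times K$ matrix $Q$, $\operatorname{LAP}(Q):=\operatorname{argmax}_{P\in\Pi_K}\operatorname{tr}(PQ)$ (the set of maximizers). Spectral matching algorithm with input $\widehat B_1,\widehat B_2$: perform an EVD $\widehat B_r=\widehat Q_r\Lambda_r\widehat Q_r^\top$ for $r=1,2$; set $\widehat S=\operatorname{diag}(\widehat S_{ii})$ with $\widehat S_{ii}=\operatorname{sign}\big([\widehat Q_2^\top\mathbf 1]_i/[\widehat Q_1^\top\mathbf 1]_i\big)$; output $\widehat S$ and the permutation matrix $\operatorname{LAP}(\widehat Q_1\widehat S\widehat Q_2^\top)$.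
   Formalization: All eigenvalue decompositions (of B_1, B_2 and those computed by the algorithm) are taken with eigenvalues listed in nonincreasing order; without a common ordering the columns could be permuted independently and permutation recovery would fail. *)

theory Defs
  imports "HOL-Analysis.Analysis"
begin

text \<open>
  The index set \<open>{1, \<dots>, K}\<close> is a finite linearly ordered type \<open>'k\<close>, so that
  \<open>K = CARD('k)\<close>. The order is used only to list eigenvalues.
  The constant \<open>1\<close> of type \<^typ>\<open>real^'k\<close> is the all-ones vector, and the norm on
  \<^typ>\<open>real^'n^'m\<close> is the Frobenius norm:
\<close>

lemma norm_matrix_eq_frobenius:
  fixes A :: "real^'n^'m"
  shows "norm A = sqrt (\<Sum>i\<in>UNIV. \<Sum>j\<in>UNIV. (A $ i $ j)\<^sup>2)"
  by (simp add: norm_vec_def L2_set_def sum_nonneg)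

definition diag :: "real^'k \<Rightarrow> real^'k^'k" where
  "diag v = (\<chi> i j. if i = j then v $ i else 0)"

definition perm_matrices :: "(real^'k^'k) set" where
  "perm_matrices = {(\<chi> i j. if j = p i then 1 else 0) | p. p permutes UNIV}"

definition sign_matrices :: "(real^'k^'k) set" where
  "sign_matrices = {diag s | s. \<forall>i. s $ i \<in> {-1, 1}}"

text \<open>
  In an eigenvalue decomposition \<open>B = Q diag(l) Q\<^sup>T\<close> the eigenvalues are listed in
  nonincreasing order; column \<open>k\<close> of \<open>Q\<close> is the eigenvector for \<open>l $ k\<close>. Without a
  common order the eigenvectors of two nearby matrices could not be compared index by index.
\<close>

definition is_evd ::
  "real^('k::{finite,linorder})^('k::{finite,linorder}) \<Rightarrow>
   real^('k::{finite,linorder})^('k::{finite,linorder}) \<Rightarrow>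
   real^('k::{finite,linorder}) \<Rightarrow> bool" where
  "is_evd B Q l \<longleftrightarrow>
     orthogonal_matrix Q \<and> (\<forall>i j. i \<le> j \<longrightarrow> l $ j \<le> l $ i) \<and>
     B = Q ** diag l ** transpose Q"

definition weighted_adjacency :: "real^'k^'k \<Rightarrow> bool" where
  "weighted_adjacency B \<longleftrightarrow> transpose B = B \<and> (\<forall>i j. B $ i $ j \<in> {0..1})"

definition friendly ::
  "real \<Rightarrow> real \<Rightarrow> real^('k::{finite,linorder})^('k::{finite,linorder}) \<Rightarrow> bool" where
  "friendly \<theta> \<eta> B \<longleftrightarrow>
     \<theta> > 0 \<and> \<eta> > 0 \<and> weighted_adjacency B \<and>
     (\<exists>Q l. is_evd B Q l \<and>
        (\<forall>i j. i \<noteq> j \<longrightarrow> \<bar>l $ i - l $ j\<bar> > \<eta>) \<and>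
        (\<forall>k. \<bar>column k Q \<bullet> 1\<bar> > \<theta>))"

definition LAP :: "real^'k^'k \<Rightarrow> (real^'k^'k) set" where
  "LAP Q = {P. is_arg_max (\<lambda>P. trace (P ** Q)) (\<lambda>P. P \<in> perm_matrices) P}"

definition sign_estimate :: "real^'k^'k \<Rightarrow> real^'k^'k \<Rightarrow> real^'k^'k" where
  "sign_estimate Q1 Q2 =
     diag (\<chi> i. sgn ((transpose Q2 *v 1) $ i / (transpose Q1 *v 1) $ i))"

text \<open>
  A run of spectral matching on the input \<open>B1\<close>, \<open>B2\<close>: \<open>Q1\<close>, \<open>Q2\<close> come from the chosen
  eigenvalue decompositions, and \<open>S\<close>, \<open>P\<close> are the output. It is a relation because
  eigenvalue decompositions and maximizers need not be unique.
\<close>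

definition spectral_matching ::
  "real^('k::{finite,linorder})^('k::{finite,linorder}) \<Rightarrow>
   real^('k::{finite,linorder})^('k::{finite,linorder}) \<Rightarrow>
   real^('k::{finite,linorder})^('k::{finite,linorder}) \<Rightarrow>
   real^('k::{finite,linorder})^('k::{finite,linorder}) \<Rightarrow>
   real^('k::{finite,linorder})^('k::{finite,linorder}) \<Rightarrow>
   real^('k::{finite,linorder})^('k::{finite,linorder}) \<Rightarrow> bool" where
  "spectral_matching B1 B2 Q1 Q2 S P \<longleftrightarrow>
     (\<exists>l. is_evd B1 Q1 l) \<and> (\<exists>l. is_evd B2 Q2 l) \<and>
     S = sign_estimate Q1 Q2 \<and>
     P \<in> LAP (Q1 ** S ** transpose Q2)"

end

theory Submission
  imports Defs
begin

text \<open>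
  Put \<open>W = Q\<^sup>T Qh\<close> for two eigenvalue decompositions. Then
  \<open>\<parallel>B - Bh\<parallel>\<^sup>2 = \<Sum>\<^sub>i\<^sub>j W\<^sub>i\<^sub>j\<^sup>2 (l\<^sub>i - lh\<^sub>j)\<^sup>2\<close> with doubly stochastic weights \<open>W\<^sub>i\<^sub>j\<^sup>2\<close>. This yields
  first Weyl's inequality and then, by the spectral gap, little mass off the diagonal of \<open>W\<close>, i.e.
  a Davis--Kahan bound \<open>\<parallel>Q - Qh S\<parallel> \<le> \<theta> / K\<close> for the whole eigenbasis with a suitable sign matrix \<open>S\<close>.
  The column sums then keep their signs, and \<open>Qh\<^sub>1 St Qh\<^sub>2\<^sup>T\<close> differs from a permutation matrix
  by less than \<open>1/2\<close> in every entry, which makes the assignment problem trivial. The case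
  \<open>B = Bh\<close> gives the uniqueness of eigenvectors up to sign, so friendliness does not depend on the
  chosen decomposition.
\<close>

section \<open>Matrix algebra and the Frobenius norm\<close>

lemma matrix_diff_ldistrib: "(A :: 'a::ring_1^'n^'m) ** (B - C) = A ** B - A ** C"
  by (vector matrix_matrix_mult_def sum_subtractf right_diff_distrib)

lemma matrix_diff_rdistrib: "(A - B) ** (C :: 'a::ring_1^'n^'m) = A ** C - B ** C"
  by (vector matrix_matrix_mult_def sum_subtractf left_diff_distrib)

lemma transpose_diff: "transpose (A - B) = transpose A - transpose (B :: 'a::ab_group_add^'n^'m)"
  by (vector transpose_def)

lemma norm_matrix_power2:
  fixes A :: "real^'n^'m"
  shows "(norm A)\<^sup>2 = (\<Sum>i\<in>UNIV. \<Sum>j\<in>UNIV. (A $ i $ j)\<^sup>2)"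
  by (simp add: norm_matrix_eq_frobenius sum_nonneg)

lemma norm_matrix_transpose:
  fixes A :: "real^'n^'m"
  shows "norm (transpose A) = norm A"
  unfolding norm_matrix_eq_frobenius transpose_def by (subst sum.swap) simp

lemma norm_matrix_power2_trace:
  fixes A :: "real^'n^'m"
  shows "(norm A)\<^sup>2 = trace (transpose A ** A)"
  unfolding norm_matrix_power2 trace_def matrix_matrix_mult_def transpose_def
  by (subst sum.swap) (simp add: power2_eq_square)

lemma norm_orthogonal_mult_left:
  fixes A :: "real^'n^'m"
  assumes "orthogonal_matrix U"
  shows "norm (U ** A) = norm A"
proof -
  have "transpose (U ** A) ** (U ** A) = transpose A ** (transpose U ** U) ** A"
    by (simp add: matrix_transpose_mul matrix_mul_assoc)
  also have "\<dots> = transpose A ** A"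
    using assms by (simp add: orthogonal_matrix)
  finally have "(norm (U ** A))\<^sup>2 = (norm A)\<^sup>2"
    by (simp add: norm_matrix_power2_trace)
  then show ?thesis by simp
qed

lemma norm_orthogonal_mult_right:
  fixes A :: "real^'n^'m"
  assumes "orthogonal_matrix U"
  shows "norm (A ** U) = norm A"
  using norm_orthogonal_mult_left[of "transpose U" "transpose A"] assms
  by (metis matrix_transpose_mul norm_matrix_transpose orthogonal_matrix_transpose)

lemma norm_entry_le_matrix:
  fixes A :: "real^'n^'m"
  shows "\<bar>A $ i $ j\<bar> \<le> norm A"
  using component_le_norm_cart[of "A $ i" j] Finite_Cartesian_Product.norm_nth_le[of A i] by linarith

lemma norm_column_le_matrix:
  fixes A :: "real^'n^'m"
  shows "norm (column j A) \<le> norm A"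
  using Finite_Cartesian_Product.norm_nth_le[of "transpose A" j] norm_matrix_transpose[of A]
  by (metis row_def row_transpose vec_lambda_eta)

lemma orthogonal_matrix_row_sum:
  fixes W :: "real^'n^'n"
  assumes "orthogonal_matrix W"
  shows "(\<Sum>j\<in>UNIV. (W $ i $ j)\<^sup>2) = 1"
proof -
  have "(W ** transpose W) $ i $ i = 1"
    using assms by (simp add: orthogonal_matrix_def mat_def)
  then show ?thesis
    by (simp add: matrix_matrix_mult_def transpose_def power2_eq_square)
qed

lemma orthogonal_matrix_column_sum:
  fixes W :: "real^'n^'n"
  assumes "orthogonal_matrix W"
  shows "(\<Sum>i\<in>UNIV. (W $ i $ j)\<^sup>2) = 1"
  using orthogonal_matrix_row_sum[of "transpose W" j] assms
  by (simp only: orthogonal_matrix_transpose) (simp add: transpose_def)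

section \<open>Diagonal, sign and permutation matrices\<close>

lemma matrix_mul_diag_nth: "(A ** diag v) $ i $ j = A $ i $ j * v $ j"
  by (simp add: matrix_matrix_mult_def diag_def if_distrib cong: if_cong)

lemma diag_mul_matrix_nth: "(diag v ** A) $ i $ j = v $ i * A $ i $ j"
proof -
  have "(\<Sum>k\<in>UNIV. (if i = k then v $ i else 0) * A $ k $ j) = (\<Sum>k\<in>UNIV. if i = k then v $ i * A $ k $ j else 0)"
    by (rule sum.cong) auto
  then show ?thesis
    by (simp add: matrix_matrix_mult_def diag_def)
qed

lemma diag_mult: "diag u ** diag v = diag (\<chi> i. u $ i * v $ i)"
  by (simp add: vec_eq_iff matrix_mul_diag_nth) (simp add: diag_def)

lemma transpose_diag: "transpose (diag v) = diag v"
  by (simp add: diag_def transpose_def vec_eq_iff)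

lemma sign_matrix_square:
  assumes "S \<in> sign_matrices"
  shows "S ** S = mat 1"
proof -
  obtain s where s: "S = diag s" "\<And>i. s $ i = -1 \<or> s $ i = 1"
    using assms by (auto simp: sign_matrices_def)
  have "s $ i * s $ i = 1" for i using s(2)[of i] by auto
  then show ?thesis by (simp add: s diag_mult) (simp add: diag_def mat_def vec_eq_iff)
qed

lemma sign_matrix_transpose:
  assumes "S \<in> sign_matrices"
  shows "transpose S = S"
  using assms by (auto simp: sign_matrices_def transpose_diag)

lemma sign_matrix_orthogonal:
  assumes "S \<in> sign_matrices"
  shows "orthogonal_matrix S"
  using assms by (simp add: orthogonal_matrix sign_matrix_square sign_matrix_transpose)

lemma perm_matrix_mult:
  assumes "P \<in> perm_matrices" "R \<in> perm_matrices"
  shows "P ** R \<in> perm_matrices"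
proof -
  obtain p r where p: "P = (\<chi> i j. if j = p i then 1 else 0)" "p permutes UNIV"
    and r: "R = (\<chi> i j. if j = r i then 1 else 0)" "r permutes UNIV"
    using assms by (auto simp: perm_matrices_def)
  have "P ** R = (\<chi> i j. if j = (r \<circ> p) i then 1 else 0)"
    by (simp add: vec_eq_iff p r matrix_matrix_mult_def if_distrib[where f = "\<lambda>x. x * _"] cong: if_cong)
  moreover have "(r \<circ> p) permutes UNIV"
    using p r by (simp add: permutes_compose)
  ultimately show ?thesis unfolding perm_matrices_def by blast
qed

lemma perm_matrix_transpose:
  assumes "P \<in> perm_matrices"
  shows "transpose P \<in> perm_matrices"
proof -
  obtain p where p: "P = (\<chi> i j. if j = p i then 1 else 0)" "p permutes UNIV"
    using assms by (auto simp: perm_matrices_def)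
  have "transpose P = (\<chi> i j. if j = inv p i then 1 else 0)"
    using permutes_inverses[OF p(2)] by (auto simp: vec_eq_iff p(1) transpose_def)
  then show ?thesis using p permutes_inv unfolding perm_matrices_def by blast
qed

lemma perm_matrix_orthogonal:
  assumes "P \<in> perm_matrices"
  shows "orthogonal_matrix P"
proof -
  obtain p where p: "P = (\<chi> i j. if j = p i then 1 else 0)" "p permutes UNIV"
    using assms by (auto simp: perm_matrices_def)
  have "(P ** transpose P) $ i $ j = (mat 1 :: real^'a^'a) $ i $ j" for i j
    using permutes_inj[OF p(2)]
    by (simp add: p matrix_matrix_mult_def transpose_def mat_def inj_eq if_distrib[where f = "\<lambda>x. x * _"] cong: if_cong)
  then have "P ** transpose P = mat 1" by (simp add: vec_eq_iff)
  then show ?thesis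
    using orthogonal_matrix_transpose[of P] by (simp add: orthogonal_matrix)
qed

text \<open>Left multiplication by \<open>P\<close> only reorders the entries within each column.
  Column sums therefore survive an unknown relabelling of the vertices, so they can serve to compare
  the signs of eigenvectors.\<close>

lemma perm_matrix_column_inner_one:
  assumes "P \<in> perm_matrices"
  shows "column k (P ** Q) \<bullet> 1 = column k Q \<bullet> 1"
proof -
  obtain p where p: "P = (\<chi> i j. if j = p i then 1 else 0)" "p permutes UNIV"
    using assms by (auto simp: perm_matrices_def)
  have "column k (P ** Q) \<bullet> 1 = (\<Sum>i\<in>UNIV. Q $ p i $ k)"
    by (simp add: p column_def matrix_matrix_mult_def inner_vec_def if_distrib[where f = "\<lambda>x. x * _"] cong: if_cong)
  also have "\<dots> = (\<Sum>i\<in>UNIV. Q $ i $ k)"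
    using sum.permute[OF p(2), of "\<lambda>i. Q $ i $ k"] by (simp add: o_def)
  finally show ?thesis by (simp add: column_def inner_vec_def)
qed

lemma column_mult_diag: "column k (A ** diag s) = s $ k *\<^sub>R column k A"
  for A :: "real^'n^'m"
  by (simp add: column_def vec_eq_iff matrix_mul_diag_nth)

lemma norm_one_vector: "norm (1 :: real^'n) = sqrt (real CARD('n))"
  by (simp add: norm_vec_def L2_set_def)

section \<open>Linear assignment near a permutation matrix\<close>

text \<open>Every entry of \<open>M\<close> at a one of the permutation exceeds every other entry.\<close>

lemma LAP_near_perm_matrix:
  fixes M P :: "real^'k^'k"
  assumes P: "P \<in> perm_matrices"
    and near: "\<And>i j. \<bar>M $ i $ j - transpose P $ i $ j\<bar> < 1 / 2"
  shows "LAP M = {P}"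
proof -
  obtain p where p: "P = (\<chi> i j. if j = p i then 1 else 0)" "p permutes UNIV"
    using P by (auto simp: perm_matrices_def)
  \<comment> \<open>Row \<open>i\<close> of the left factor selects row \<open>r i\<close> of
    \<open>M\<close>, so the trace collects the entries at \<open>(r i, i)\<close>. For
    \<open>P\<close> these are the positions of the ones of \<open>transpose P\<close>, whence the
    transpose in \<open>near\<close>.\<close>
  have tr: "trace ((\<chi> i j. if j = r i then 1 else 0) ** M) = (\<Sum>i\<in>UNIV. M $ r i $ i)" for r :: "'k \<Rightarrow> 'k"
    by (simp add: trace_def matrix_matrix_mult_def if_distrib[where f = "\<lambda>x. x * _"] cong: if_cong)
  have big: "M $ p i $ i > 1 / 2" for i
    using near[of "p i" i] by (simp add: p transpose_def abs_if split: if_splits)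
  have small: "M $ j $ i < 1 / 2" if "j \<noteq> p i" for i j
    using near[of j i] that by (simp add: p transpose_def abs_if split: if_splits)
  have less: "trace (R ** M) < trace (P ** M)" if R: "R \<in> perm_matrices" "R \<noteq> P" for R
  proof -
    obtain r where r: "R = (\<chi> i j. if j = r i then 1 else 0)" "r permutes UNIV"
      using R by (auto simp: perm_matrices_def)
    have "r \<noteq> p" using R(2) p(1) r(1) by auto
    then obtain i where i: "r i \<noteq> p i" by auto
    have lt: "M $ r i $ i < M $ p i $ i" if "r i \<noteq> p i" for i
      using big[of i] small[OF that] by linarith
    have le: "M $ r i $ i \<le> M $ p i $ i" for i
      using lt[of i] by (cases "r i = p i") auto
    have "(\<Sum>i\<in>UNIV. M $ r i $ i) < (\<Sum>i\<in>UNIV. M $ p i $ i)"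
      by (rule sum_strict_mono_ex1) (use lt[OF i] le in auto)
    then show ?thesis by (simp add: p(1) r(1) tr)
  qed
  then have "x = P" if "x \<in> LAP M" for x
    using that P by (auto simp: LAP_def is_arg_max_def)
  moreover have "P \<in> LAP M"
    using less P by (force simp: LAP_def is_arg_max_def)
  ultimately show ?thesis by blast
qed

section \<open>Doubly stochastic weights\<close>

text \<open>
  In a doubly stochastic matrix the rows \<open>i \<ge> k\<close> and columns \<open>j \<le> k\<close> number \<open>K + 1\<close> together, so
  the block they cut out has mass at least \<open>1\<close>.
\<close>

lemma doubly_stochastic_block:
  fixes D :: "('k::{finite,linorder}) \<Rightarrow> 'k \<Rightarrow> real"
  assumes nonneg: "\<And>i j. D i j \<ge> 0"
    and row: "\<And>i. (\<Sum>j\<in>UNIV. D i j) = 1" and col: "\<And>j. (\<Sum>i\<in>UNIV. D i j) = 1"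
  shows "(\<Sum>i\<in>{k..}. \<Sum>j\<in>{..k}. D i j) \<ge> 1"
proof -
  \<comment> \<open>The columns up to and including \<open>k\<close> carry mass
    \<open>card {..k}\<close>. The rows before \<open>k\<close> hold at most
    \<open>card {..<k}\<close> of it, one less; the rest lies in the block.\<close>
  have "real (card {..k}) = (\<Sum>j\<in>{..k}. \<Sum>i\<in>UNIV. D i j)" by (simp add: col)
  also have "\<dots> = (\<Sum>j\<in>{..k}. (\<Sum>i\<in>{k..}. D i j) + (\<Sum>i\<in>{..<k}. D i j))"
  proof (rule sum.cong)
    fix j
    have "(\<Sum>i\<in>{k..} \<union> {..<k}. D i j) = (\<Sum>i\<in>{k..}. D i j) + (\<Sum>i\<in>{..<k}. D i j)"
      by (rule sum.union_disjoint) auto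
    moreover have "{k..} \<union> {..<k} = UNIV" by auto
    ultimately show "(\<Sum>i\<in>UNIV. D i j) = (\<Sum>i\<in>{k..}. D i j) + (\<Sum>i\<in>{..<k}. D i j)" by simp
  qed simp
  also have "\<dots> = (\<Sum>i\<in>{k..}. \<Sum>j\<in>{..k}. D i j) + (\<Sum>i\<in>{..<k}. \<Sum>j\<in>{..k}. D i j)"
    unfolding sum.distrib by (simp add: sum.swap[of _ "{..k}"])
  also have "(\<Sum>i\<in>{..<k}. \<Sum>j\<in>{..k}. D i j) \<le> (\<Sum>i\<in>{..<k}. \<Sum>j\<in>UNIV. D i j)"
    by (intro sum_mono sum_mono2) (auto simp: nonneg)
  also have "\<dots> = real (card {..<k})" by (simp add: row)
  finally have "real (card {..k}) \<le> (\<Sum>i\<in>{k..}. \<Sum>j\<in>{..k}. D i j) + real (card {..<k})" by simp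
  moreover have "{..k} = insert k {..<k}" by auto
  then have "card {..k} = Suc (card {..<k})" by simp
  ultimately show ?thesis by simp
qed

lemma doubly_stochastic_sorted_gap:
  fixes D :: "('k::{finite,linorder}) \<Rightarrow> 'k \<Rightarrow> real" and a b :: "'k \<Rightarrow> real"
  assumes nonneg: "\<And>i j. D i j \<ge> 0"
    and row: "\<And>i. (\<Sum>j\<in>UNIV. D i j) = 1" and col: "\<And>j. (\<Sum>i\<in>UNIV. D i j) = 1"
    and a: "\<And>i j. i \<le> j \<Longrightarrow> a j \<le> a i" and b: "\<And>i j. i \<le> j \<Longrightarrow> b j \<le> b i"
    and ab: "a k \<le> b k"
  shows "(a k - b k)\<^sup>2 \<le> (\<Sum>i\<in>UNIV. \<Sum>j\<in>UNIV. D i j * (a i - b j)\<^sup>2)"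
proof -
  have "(a k - b k)\<^sup>2 * 1 \<le> (a k - b k)\<^sup>2 * (\<Sum>i\<in>{k..}. \<Sum>j\<in>{..k}. D i j)"
    using doubly_stochastic_block[of D k, OF nonneg row col] by (intro mult_left_mono) auto
  also have "\<dots> = (\<Sum>i\<in>{k..}. \<Sum>j\<in>{..k}. D i j * (a k - b k)\<^sup>2)"
    by (simp add: sum_distrib_left sum_distrib_right mult.commute)
  also have "\<dots> \<le> (\<Sum>i\<in>{k..}. \<Sum>j\<in>{..k}. D i j * (a i - b j)\<^sup>2)"
  proof (intro sum_mono mult_left_mono)
    fix i j assume "i \<in> {k..}" "j \<in> {..k}"
    then have "b k - a k \<le> b j - a i" using a[of k i] b[of j k] by auto
    then have "(b k - a k)\<^sup>2 \<le> (b j - a i)\<^sup>2" using ab by (intro power_mono) auto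
    then show "(a k - b k)\<^sup>2 \<le> (a i - b j)\<^sup>2" by (simp add: power2_commute)
  qed (rule nonneg)
  also have "\<dots> \<le> (\<Sum>i\<in>{k..}. \<Sum>j\<in>UNIV. D i j * (a i - b j)\<^sup>2)"
    by (intro sum_mono sum_mono2) (auto simp: nonneg)
  also have "\<dots> \<le> (\<Sum>i\<in>UNIV. \<Sum>j\<in>UNIV. D i j * (a i - b j)\<^sup>2)"
    by (intro sum_mono2) (auto simp: nonneg intro!: sum_nonneg)
  finally show ?thesis by simp
qed

section \<open>Perturbation of eigenvalues and eigenvectors\<close>

text \<open>Orthogonal factors preserve the norm, and multiplying \<open>B - Bh\<close> by
  \<open>transpose Q\<close> on the left and \<open>Qh\<close> on the right leaves
  \<open>diag l ** W - W ** diag lh\<close>, with entries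
  \<open>W $ i $ j * (l $ i - lh $ j)\<close>.\<close>

lemma evd_difference_norm:
  fixes Q Qh :: "real^('k::{finite,linorder})^('k::{finite,linorder})"
  assumes "is_evd B Q l" "is_evd Bh Qh lh"
  defines "W \<equiv> transpose Q ** Qh"
  shows "orthogonal_matrix W"
    and "(norm (B - Bh))\<^sup>2 = (\<Sum>i\<in>UNIV. \<Sum>j\<in>UNIV. (W $ i $ j)\<^sup>2 * (l $ i - lh $ j)\<^sup>2)"
proof -
  have Q: "orthogonal_matrix Q" "B = Q ** diag l ** transpose Q"
    and Qh: "orthogonal_matrix Qh" "Bh = Qh ** diag lh ** transpose Qh"
    using assms by (auto simp: is_evd_def)
  show "orthogonal_matrix W"
    unfolding W_def using Q Qh by (simp add: orthogonal_matrix_mul orthogonal_matrix_transpose)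
  have QQ: "transpose Q ** Q = mat 1" "transpose Qh ** Qh = mat 1"
    using Q Qh by (auto simp: orthogonal_matrix)
  have "transpose Q ** B = (transpose Q ** Q) ** diag l ** transpose Q"
    by (simp add: Q(2) matrix_mul_assoc)
  then have "transpose Q ** B ** Qh = diag l ** W"
    by (simp add: QQ W_def matrix_mul_assoc)
  moreover have "Bh ** Qh = Qh ** diag lh ** (transpose Qh ** Qh)"
    by (simp add: Qh(2) matrix_mul_assoc)
  then have "transpose Q ** Bh ** Qh = W ** diag lh"
    by (simp add: QQ W_def flip: matrix_mul_assoc)
  ultimately have "transpose Q ** (B - Bh) ** Qh = diag l ** W - W ** diag lh"
    by (simp add: matrix_diff_ldistrib matrix_diff_rdistrib)
  then have "(norm (B - Bh))\<^sup>2 = (norm (diag l ** W - W ** diag lh))\<^sup>2"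
    using Q Qh by (metis norm_orthogonal_mult_left norm_orthogonal_mult_right orthogonal_matrix_transpose)
  also have "\<dots> = (\<Sum>i\<in>UNIV. \<Sum>j\<in>UNIV. (W $ i $ j)\<^sup>2 * (l $ i - lh $ j)\<^sup>2)"
    unfolding norm_matrix_power2
    by (intro sum.cong refl) (simp add: matrix_mul_diag_nth diag_mul_matrix_nth power2_eq_square algebra_simps)
  finally show "(norm (B - Bh))\<^sup>2 = (\<Sum>i\<in>UNIV. \<Sum>j\<in>UNIV. (W $ i $ j)\<^sup>2 * (l $ i - lh $ j)\<^sup>2)" .
qed

text \<open>The squared entries of the orthogonal matrix \<open>W\<close> are doubly stochastic
  weights, so the sorted gap estimate applies. It covers one sign of \<open>l $ k - lh $ k\<close>;
  the other follows by exchanging the two spectra and transposing the weights.\<close>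

lemma evd_eigenvalue_perturbation:
  assumes evd: "is_evd B Q l" "is_evd Bh Qh lh"
  shows "\<bar>l $ k - lh $ k\<bar> \<le> norm (B - Bh)"
proof -
  define W where "W = transpose Q ** Qh"
  note W = evd_difference_norm[OF evd, folded W_def]
  have l: "\<And>i j. i \<le> j \<Longrightarrow> l $ j \<le> l $ i" and lh: "\<And>i j. i \<le> j \<Longrightarrow> lh $ j \<le> lh $ i"
    using evd by (auto simp: is_evd_def)
  have "(l $ k - lh $ k)\<^sup>2 \<le> (norm (B - Bh))\<^sup>2"
  proof (cases "l $ k \<le> lh $ k")
    case True
    have "(l $ k - lh $ k)\<^sup>2 \<le> (\<Sum>i\<in>UNIV. \<Sum>j\<in>UNIV. (W $ i $ j)\<^sup>2 * (l $ i - lh $ j)\<^sup>2)"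
      by (rule doubly_stochastic_sorted_gap)
        (use True l lh in \<open>auto simp: orthogonal_matrix_row_sum[OF W(1)] orthogonal_matrix_column_sum[OF W(1)]\<close>)
    then show ?thesis by (simp add: W(2))
  next
    case False
    have "(lh $ k - l $ k)\<^sup>2 \<le> (\<Sum>j\<in>UNIV. \<Sum>i\<in>UNIV. (W $ i $ j)\<^sup>2 * (lh $ j - l $ i)\<^sup>2)"
      by (rule doubly_stochastic_sorted_gap)
        (use False l lh in \<open>auto simp: orthogonal_matrix_row_sum[OF W(1)] orthogonal_matrix_column_sum[OF W(1)]\<close>)
    also have "\<dots> = (\<Sum>i\<in>UNIV. \<Sum>j\<in>UNIV. (W $ i $ j)\<^sup>2 * (l $ i - lh $ j)\<^sup>2)"
      by (subst sum.swap) (simp add: power2_commute)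
    finally show ?thesis by (simp add: W(2) power2_commute)
  qed
  then show ?thesis by (metis abs_le_square_iff abs_norm_cancel)
qed

lemma evd_eigenvector_perturbation:
  fixes Q Qh :: "real^('k::{finite,linorder})^('k::{finite,linorder})"
  assumes evd: "is_evd B Q l" "is_evd Bh Qh lh"
    and gap: "\<And>i j. i \<noteq> j \<Longrightarrow> \<bar>l $ i - l $ j\<bar> \<ge> \<eta>"
    and small: "norm (B - Bh) < \<eta>"
  shows "\<exists>S\<in>sign_matrices. norm (Q - Qh ** S) \<le> sqrt 2 * norm (B - Bh) / (\<eta> - norm (B - Bh))"
proof -
  define e where "e = norm (B - Bh)"
  define W where "W = transpose Q ** Qh"
  \<comment> \<open>The off-diagonal mass of \<open>W\<close>, extended by zero so that all sums run
    over the full index type.\<close>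
  define D where "D = (\<lambda>i j. if i = j then 0 else (W $ i $ j)\<^sup>2)"
  note W = evd_difference_norm[OF evd, folded W_def]
  have "D i j * (\<eta> - norm (B - Bh))\<^sup>2 \<le> (W $ i $ j)\<^sup>2 * (l $ i - lh $ j)\<^sup>2" for i j
  proof (cases "i = j")
    case False
    \<comment> \<open>Triangle inequality through \<open>l $ j\<close>: the gap separates
      \<open>l $ i\<close> from \<open>l $ j\<close>, and \<open>lh $ j\<close> is within
      \<open>norm (B - Bh)\<close> of \<open>l $ j\<close>.\<close>
    have "\<eta> - norm (B - Bh) \<le> \<bar>l $ i - lh $ j\<bar>"
      using gap[OF False] evd_eigenvalue_perturbation[OF evd, of j] by linarith
    then have "(\<eta> - norm (B - Bh))\<^sup>2 \<le> \<bar>l $ i - lh $ j\<bar>\<^sup>2"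
      using small by (intro power_mono) auto
    then show ?thesis using False by (simp add: D_def mult_left_mono)
  qed (simp add: D_def)
  then have off: "(\<Sum>i\<in>UNIV. \<Sum>j\<in>UNIV. D i j) * (\<eta> - e)\<^sup>2 \<le> e\<^sup>2"
    using W(2) by (simp only: sum_distrib_right e_def sum_mono)
  \<comment> \<open>With this choice \<open>W $ k $ k * s $ k\<close> is the absolute value of
    \<open>W $ k $ k\<close>. A zero entry gets 1, so that \<open>diag s\<close> is a sign matrix in
    every case.\<close>
  define s where "s = ((\<chi> k. if W $ k $ k < 0 then -1 else 1) :: real^('k::{finite,linorder}))"
  have "s $ i \<in> {-1, 1}" for i by (simp add: s_def)
  then have s: "diag s \<in> sign_matrices" unfolding sign_matrices_def by blast
  have Q: "orthogonal_matrix Q" using evd by (simp add: is_evd_def)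
  have diagonal: "(1 - \<bar>W $ i $ i\<bar>)\<^sup>2 \<le> (\<Sum>j\<in>UNIV. D i j)" for i
  proof -
    have "(\<Sum>j\<in>UNIV. (W $ i $ j)\<^sup>2) = (W $ i $ i)\<^sup>2 + (\<Sum>j\<in>UNIV - {i}. (W $ i $ j)\<^sup>2)"
      by (rule sum.remove) auto
    also have "(\<Sum>j\<in>UNIV - {i}. (W $ i $ j)\<^sup>2) = (\<Sum>j\<in>UNIV. D i j)"
      by (rule sum.mono_neutral_cong_left) (auto simp: D_def)
    finally have w: "(\<Sum>j\<in>UNIV. D i j) = 1 - \<bar>W $ i $ i\<bar>\<^sup>2"
      by (simp add: orthogonal_matrix_row_sum[OF W(1)])
    have "(\<Sum>j\<in>UNIV. D i j) \<ge> 0" by (intro sum_nonneg) (simp add: D_def)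
    then have "\<bar>W $ i $ i\<bar> \<le> 1" using w abs_square_le_1 by fastforce
    \<comment> \<open>For w in [0,1] one has (1-w)(1-w) \<le> (1-w)(1+w) = 1 - w*w, and the right
      side is the off-diagonal mass of the row because rows of \<open>W\<close> have norm 1.\<close>
    then have "(1 - \<bar>W $ i $ i\<bar>) * (1 - \<bar>W $ i $ i\<bar>) \<le> (1 - \<bar>W $ i $ i\<bar>) * (1 + \<bar>W $ i $ i\<bar>)"
      by (intro mult_left_mono) auto
    then show ?thesis unfolding w by (simp add: power2_eq_square algebra_simps)
  qed
  have "transpose Q ** (Q - Qh ** diag s) = mat 1 - W ** diag s"
    using Q by (simp add: matrix_diff_ldistrib orthogonal_matrix W_def matrix_mul_assoc)
  then have "(norm (Q - Qh ** diag s))\<^sup>2 = (norm (mat 1 - W ** diag s))\<^sup>2"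
    using Q by (metis norm_orthogonal_mult_left orthogonal_matrix_transpose)
  also have "\<dots> = (\<Sum>i\<in>UNIV. \<Sum>j\<in>UNIV. (if i = j then (1 - \<bar>W $ i $ i\<bar>)\<^sup>2 else 0) + D i j)"
    unfolding norm_matrix_power2
    by (intro sum.cong refl) (auto simp: matrix_mul_diag_nth mat_def D_def s_def)
  also have "\<dots> = (\<Sum>i\<in>UNIV. (1 - \<bar>W $ i $ i\<bar>)\<^sup>2 + (\<Sum>j\<in>UNIV. D i j))"
    by (simp add: sum.distrib)
  \<comment> \<open>Each row contributes its off-diagonal mass once directly and at most once more
    through the diagonal defect. This is the source of the factor \<open>sqrt 2\<close>.\<close>
  also have "\<dots> \<le> (\<Sum>i\<in>UNIV. 2 * (\<Sum>j\<in>UNIV. D i j))"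
    unfolding mult_2 by (rule sum_mono) (rule add_right_mono[OF diagonal])
  also have "\<dots> = 2 * (\<Sum>i\<in>UNIV. \<Sum>j\<in>UNIV. D i j)" by (simp only: sum_distrib_left)
  also have "\<dots> \<le> 2 * (e\<^sup>2 / (\<eta> - e)\<^sup>2)"
    using off small by (intro mult_left_mono) (auto simp: e_def pos_le_divide_eq)
  also have "\<dots> = (sqrt 2 * e / (\<eta> - e))\<^sup>2" by (simp add: power_mult_distrib power_divide)
  finally have "norm (Q - Qh ** diag s) \<le> sqrt 2 * e / (\<eta> - e)"
    using small by (elim power2_le_imp_le) (simp add: e_def)
  with s show ?thesis unfolding e_def by blast
qed

section \<open>Friendly matrices and their estimates\<close>

text \<open>\<open>friendly\<close> only provides some decomposition, while the theorem fixes its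
  own. Comparing the two with perturbation 0 shows equal eigenvalues and eigenvectors equal up to
  sign, which leaves absolute column sums unchanged.\<close>

lemma friendly_evd:
  assumes "friendly \<theta> \<eta> B" and evd: "is_evd B Q l"
  shows "\<And>i j. i \<noteq> j \<Longrightarrow> \<bar>l $ i - l $ j\<bar> > \<eta>" and "\<And>k. \<bar>column k Q \<bullet> 1\<bar> > \<theta>"
proof -
  obtain Q' l' where evd': "is_evd B Q' l'"
    and gap: "\<And>i j. i \<noteq> j \<Longrightarrow> \<bar>l' $ i - l' $ j\<bar> > \<eta>" and main: "\<And>k. \<bar>column k Q' \<bullet> 1\<bar> > \<theta>"
    and pos: "\<eta> > 0"
    using assms(1) unfolding friendly_def by blast
  have "l' $ i = l $ i" for i
    using evd_eigenvalue_perturbation[OF evd' evd, of i] by simp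
  with gap show "\<And>i j. i \<noteq> j \<Longrightarrow> \<bar>l $ i - l $ j\<bar> > \<eta>" by simp
  obtain S where S: "S \<in> sign_matrices" "norm (Q' - Q ** S) \<le> 0"
    using evd_eigenvector_perturbation[OF evd' evd, of \<eta>] gap pos by (force simp: less_imp_le)
  then obtain s where s: "S = diag s" "\<And>i. s $ i = -1 \<or> s $ i = 1"
    by (auto simp: sign_matrices_def)
  have "Q' = Q ** diag s" using S s by simp
  then have "column k Q' \<bullet> 1 = s $ k * (column k Q \<bullet> 1)" for k
    by (simp add: column_mult_diag)
  then have "\<bar>column k Q' \<bullet> 1\<bar> = \<bar>column k Q \<bullet> 1\<bar>" for k
    using s(2)[of k] by (auto simp: abs_mult)
  with main show "\<And>k. \<bar>column k Q \<bullet> 1\<bar> > \<theta>" by simp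
qed

lemma is_evd_perm:
  assumes "is_evd B Q l" "P \<in> perm_matrices"
  shows "is_evd (P ** B ** transpose P) (P ** Q) l"
  using assms perm_matrix_orthogonal[OF assms(2)]
  by (simp add: is_evd_def orthogonal_matrix_mul matrix_transpose_mul matrix_mul_assoc)

text \<open>The error bound gives \<open>sqrt 2 * e \<le> \<theta> / K * (\<eta> / 2)\<close>, and
  since \<open>\<theta> / K \<le> 1\<close> also \<open>e \<le> \<eta> / 2\<close>. So the
  denominator \<open>\<eta> - e\<close> is at least \<open>\<eta> / 2\<close> and the perturbation
  bound becomes \<open>\<theta> / K\<close>. The minimizer \<open>S\<close> does no worse than the
  sign matrix found there.\<close>

lemma estimate_eigenvectors_near:
  fixes Q :: "real^('k::{finite,linorder})^('k::{finite,linorder})"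
  assumes pos: "\<theta> > 0" "\<eta> > 0" and theta: "\<theta> < 1 / (4 * sqrt (real CARD('k)))"
    and evd: "is_evd B Q l" "is_evd Bh Qh lh"
    and gap: "\<And>i j. i \<noteq> j \<Longrightarrow> \<bar>l $ i - l $ j\<bar> > \<eta>"
    and P: "P \<in> perm_matrices"
    and est: "norm (B - P ** Bh ** transpose P) \<le> \<theta> * \<eta> / (2 * sqrt 2 * real CARD('k))"
    and S: "is_arg_min (\<lambda>S. norm (Q - P ** Qh ** S)) (\<lambda>S. S \<in> sign_matrices) S"
  shows "norm (Q - P ** Qh ** S) \<le> \<theta> / real CARD('k)"
proof -
  define K where "K = real CARD('k)"
  define e where "e = norm (B - P ** Bh ** transpose P)"
  have K: "K \<ge> 1" unfolding K_def using zero_less_card_finite[where ?'a = 'k] by linarith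
  have "1 / (4 * sqrt K) \<le> 1 / 1"
    by (rule divide_left_mono) (use real_sqrt_ge_one[OF K] in linarith)+
  then have "\<theta> \<le> 1" using theta unfolding K_def by linarith
  have e: "sqrt 2 * e \<le> \<theta> / K * (\<eta> / 2)"
    using est K unfolding e_def K_def[symmetric] by (simp add: field_simps)
  have "\<theta> / K \<le> 1" using K \<open>\<theta> \<le> 1\<close> by simp
  then have "\<theta> / K * (\<eta> / 2) \<le> 1 * (\<eta> / 2)" using pos by (intro mult_right_mono) auto
  moreover have "1 * e \<le> sqrt 2 * e" by (intro mult_right_mono) (auto simp: e_def)
  ultimately have half: "e \<le> \<eta> / 2" using e by linarith
  obtain S' where S': "S' \<in> sign_matrices"
    "norm (Q - P ** Qh ** S') \<le> sqrt 2 * e / (\<eta> - e)"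
    using evd_eigenvector_perturbation[OF evd(1) is_evd_perm[OF evd(2) P], of \<eta>] gap half pos
    unfolding e_def by (force simp: less_imp_le)
  have "norm (Q - P ** Qh ** S) \<le> norm (Q - P ** Qh ** S')"
    using S S'(1) by (auto simp: is_arg_min_def not_less)
  also note S'(2)
  also have "sqrt 2 * e / (\<eta> - e) \<le> \<theta> / K"
  proof -
    have "\<theta> / K * (\<eta> / 2) \<le> \<theta> / K * (\<eta> - e)" using half pos K by (intro mult_left_mono) auto
    with e half pos show ?thesis by (simp add: pos_divide_le_eq)
  qed
  finally show ?thesis by (simp add: K_def)
qed

text \<open>By Cauchy-Schwarz with the all-ones vector, of norm \<open>sqrt K\<close>, the column
  sum moves by at most \<open>\<theta> / K * sqrt K \<le> \<theta>\<close>. Its modulus exceeds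
  \<open>\<theta>\<close>, so it cannot change sign.\<close>

lemma sgn_column_sum_recovery:
  fixes Q Qh :: "real^'k^'k"
  assumes near: "norm (Q - P ** Qh ** diag s) \<le> \<theta> / real CARD('k)"
    and P: "P \<in> perm_matrices" and s: "s $ i = -1 \<or> s $ i = 1"
    and theta: "\<theta> > 0" "\<bar>column i Q \<bullet> 1\<bar> > \<theta>"
  shows "sgn (column i Qh \<bullet> 1) = s $ i * sgn (column i Q \<bullet> 1)"
proof -
  define K where "K = real CARD('k)"
  have K: "K \<ge> 1" unfolding K_def using zero_less_card_finite[where ?'a = 'k] by linarith
  have "column i Q \<bullet> 1 - s $ i * (column i Qh \<bullet> 1) = column i (Q - P ** Qh ** diag s) \<bullet> 1"
  proof -
    have "column i (Q - P ** Qh ** diag s) = column i Q - s $ i *\<^sub>R column i (P ** Qh)"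
      by (simp flip: column_mult_diag) (simp add: column_def vec_eq_iff)
    then show ?thesis by (simp add: inner_diff_left perm_matrix_column_inner_one[OF P])
  qed
  then have "\<bar>column i Q \<bullet> 1 - s $ i * (column i Qh \<bullet> 1)\<bar>
      \<le> norm (column i (Q - P ** Qh ** diag s)) * norm (1 :: real^'k)"
    by (simp add: Cauchy_Schwarz_ineq2)
  also have "\<dots> \<le> \<theta> / K * sqrt K"
    unfolding norm_one_vector K_def
    by (intro mult_right_mono order_trans[OF norm_column_le_matrix near]) auto
  also have "\<dots> \<le> \<theta> / K * K"
    using K theta by (intro mult_left_mono) (auto simp: real_le_lsqrt power2_eq_square)
  also have "\<dots> = \<theta>" using K by simp
  finally show ?thesis using theta s by (auto simp: sgn_if split: if_splits)
qed

lemma transpose_mult_one_nth: "(transpose Q *v 1) $ i = column i Q \<bullet> 1"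
  for Q :: "real^'n^'m"
  by (simp add: matrix_vector_mult_def transpose_def column_def inner_vec_def)


section \<open>Recovery of the signs and of the permutation\<close>

theorem theorem1:
  fixes B1 B2 Bh1 Bh2 Q1 Q2 Qh1 Qh2 Ps P1 P2 Ph Pt Ss S1 S2 Sh St ::
      "real^('k::{finite,linorder})^('k::{finite,linorder})"
    and l :: "real^('k::{finite,linorder})"
    and \<theta> \<eta> :: real
  assumes friendly: "friendly \<theta> \<eta> B1" "friendly \<theta> \<eta> B2"
    and theta: "\<theta> < 1 / (4 * sqrt (real CARD('k)))"
    and evd: "is_evd B1 Q1 l" "is_evd B2 Q2 l"
    and Ps: "Ps \<in> perm_matrices" "B2 = Ps ** B1 ** transpose Ps"
    and Ss: "Ss \<in> sign_matrices" "Q2 = Ps ** Q1 ** Ss"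
    and P12: "P1 \<in> perm_matrices" "P2 \<in> perm_matrices"
    and est1: "norm (B1 - P1 ** Bh1 ** transpose P1)
                 \<le> \<theta> * \<eta> / (2 * sqrt 2 * real CARD('k))"
    and est2: "norm (B2 - P2 ** Bh2 ** transpose P2)
                 \<le> \<theta> * \<eta> / (2 * sqrt 2 * real CARD('k))"
    and alg: "spectral_matching Bh1 Bh2 Qh1 Qh2 Sh Ph"
    and S1: "is_arg_min (\<lambda>S. norm (Q1 - P1 ** Qh1 ** S)) (\<lambda>S. S \<in> sign_matrices) S1"
    and S2: "is_arg_min (\<lambda>S. norm (Q2 - P2 ** Qh2 ** S)) (\<lambda>S. S \<in> sign_matrices) S2"
    and St: "St = S1 ** Ss ** S2"
    and Pt: "Pt = transpose P2 ** Ps ** P1"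
  shows "Sh = St \<and>
    LAP (Qh1 ** St ** transpose Qh2) = {Pt} \<and>
    Ph = Pt \<and>
    norm (Bh2 - Pt ** Bh1 ** transpose Pt)
      \<le> norm (B1 - P1 ** Bh1 ** transpose P1) + norm (B2 - P2 ** Bh2 ** transpose P2)"
proof -
  define K where "K = real CARD('k)"
  have K: "K \<ge> 1" unfolding K_def using zero_less_card_finite[where ?'a = 'k] by linarith
  have pos: "\<theta> > 0" "\<eta> > 0" using friendly by (auto simp: friendly_def)
  obtain lh1 lh2 where evdh: "is_evd Bh1 Qh1 lh1" "is_evd Bh2 Qh2 lh2"
    and Sh: "Sh = sign_estimate Qh1 Qh2" and Ph: "Ph \<in> LAP (Qh1 ** Sh ** transpose Qh2)"
    using alg by (auto simp: spectral_matching_def)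
  have near1: "norm (Q1 - P1 ** Qh1 ** S1) \<le> \<theta> / K"
    unfolding K_def
    using friendly_evd(1)[OF friendly(1) evd(1)]
    by (intro estimate_eigenvectors_near[OF pos theta evd(1) evdh(1) _ P12(1) est1 S1]) auto
  have near2: "norm (Q2 - P2 ** Qh2 ** S2) \<le> \<theta> / K"
    unfolding K_def
    using friendly_evd(1)[OF friendly(2) evd(2)]
    by (intro estimate_eigenvectors_near[OF pos theta evd(2) evdh(2) _ P12(2) est2 S2]) auto
  have sign: "S1 \<in> sign_matrices" "S2 \<in> sign_matrices"
    using S1 S2 by (auto simp: is_arg_min_def)
  obtain s1 s2 ss where s: "S1 = diag s1" "S2 = diag s2" "Ss = diag ss"
    and pm: "\<And>i. s1 $ i = -1 \<or> s1 $ i = 1" "\<And>i. s2 $ i = -1 \<or> s2 $ i = 1"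
      "\<And>i. ss $ i = -1 \<or> ss $ i = 1"
    using sign Ss(1) by (auto simp: sign_matrices_def)
  have "Sh = St"
  proof -
    have "sgn ((column i Qh2 \<bullet> 1) / (column i Qh1 \<bullet> 1)) = s1 $ i * ss $ i * s2 $ i" for i
    proof -
      have u: "\<bar>column i Q1 \<bullet> 1\<bar> > \<theta>" by (rule friendly_evd(2)[OF friendly(1) evd(1)])
      have "column i Q2 \<bullet> 1 = ss $ i * (column i Q1 \<bullet> 1)"
        unfolding Ss(2) s by (simp add: column_mult_diag perm_matrix_column_inner_one[OF Ps(1)])
      then have "sgn (column i Q2 \<bullet> 1) = ss $ i * sgn (column i Q1 \<bullet> 1)"
        using pm(3)[of i] by (auto simp: sgn_mult)
      moreover have "sgn (column i Qh1 \<bullet> 1) = s1 $ i * sgn (column i Q1 \<bullet> 1)"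
        by (rule sgn_column_sum_recovery[OF near1[unfolded K_def s] P12(1) pm(1) pos(1) u])
      moreover have "sgn (column i Qh2 \<bullet> 1) = s2 $ i * sgn (column i Q2 \<bullet> 1)"
        by (rule sgn_column_sum_recovery[OF near2[unfolded K_def s] P12(2) pm(2) pos(1)
              friendly_evd(2)[OF friendly(2) evd(2)]])
      \<comment> \<open>Being nonzero, the sign of the column sum of \<open>Q1\<close> occurs in
        numerator and denominator and cancels, leaving the product of the three signs.\<close>
      moreover have "sgn (column i Q1 \<bullet> 1) = -1 \<or> sgn (column i Q1 \<bullet> 1) = 1"
        using u pos by (auto simp: sgn_if)
      ultimately show ?thesis
        using pm(1)[of i] by (auto simp: sgn_divide)
    qed
    then show ?thesis
      by (simp only: Sh sign_estimate_def transpose_mult_one_nth St s diag_mult vec_lambda_beta)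
  qed
  moreover have LAP: "LAP (Qh1 ** St ** transpose Qh2) = {Pt}"
  proof (rule LAP_near_perm_matrix)
    show "Pt \<in> perm_matrices"
      unfolding Pt using P12 Ps(1) by (intro perm_matrix_mult perm_matrix_transpose)
    have orth: "orthogonal_matrix P1" "orthogonal_matrix P2" "orthogonal_matrix Ps"
      using P12 Ps(1) by (auto intro: perm_matrix_orthogonal)
    have orthQ: "orthogonal_matrix Q1" "orthogonal_matrix Qh2"
      using evd evdh by (auto simp: is_evd_def)
    \<comment> \<open>The estimated eigenbases, relabelled and sign-aligned, so that
      \<open>A\<close> is close to \<open>Q1\<close> and \<open>C\<close> to
      \<open>Q2\<close>.\<close>
    define A where "A = P1 ** Qh1 ** S1"
    define C where "C = P2 ** Qh2 ** S2"
    have C: "orthogonal_matrix C"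
      unfolding C_def using orth orthQ sign_matrix_orthogonal[OF sign(2)] by (intro orthogonal_matrix_mul)
    have "Q1 ** Ss ** transpose Q2 = Q1 ** (Ss ** Ss) ** transpose Q1 ** transpose Ps"
      by (simp add: Ss(2) matrix_transpose_mul sign_matrix_transpose[OF Ss(1)] matrix_mul_assoc)
    also have "\<dots> = transpose Ps"
      using orthQ(1) by (simp add: sign_matrix_square[OF Ss(1)] orthogonal_matrix_def)
    finally have Ps_eq: "Q1 ** Ss ** transpose Q2 = transpose Ps" .
    have "P1 ** (Qh1 ** St ** transpose Qh2) ** transpose P2 = A ** Ss ** transpose C"
      by (simp add: St A_def C_def matrix_transpose_mul sign_matrix_transpose[OF sign(2)] matrix_mul_assoc)
    moreover have "P1 ** transpose Pt ** transpose P2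
        = (P1 ** transpose P1) ** transpose Ps ** (P2 ** transpose P2)"
      by (simp add: Pt matrix_transpose_mul matrix_mul_assoc)
    then have "P1 ** transpose Pt ** transpose P2 = transpose Ps"
      using orth by (simp add: orthogonal_matrix_def)
    ultimately have "P1 ** (Qh1 ** St ** transpose Qh2 - transpose Pt) ** transpose P2
        = A ** Ss ** transpose C - Q1 ** Ss ** transpose Q2"
      by (simp add: matrix_diff_ldistrib matrix_diff_rdistrib Ps_eq)
    \<comment> \<open>Telescoping through \<open>Q1 ** Ss ** transpose C\<close>: each term contains
      one small factor, and the other factors are orthogonal.\<close>
    also have "\<dots> = - ((Q1 - A) ** (Ss ** transpose C)) - (Q1 ** Ss) ** transpose (Q2 - C)"
      by (simp add: matrix_diff_ldistrib matrix_diff_rdistrib matrix_mul_assoc transpose_diff)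
    finally have "norm (P1 ** (Qh1 ** St ** transpose Qh2 - transpose Pt) ** transpose P2)
        \<le> norm ((Q1 - A) ** (Ss ** transpose C)) + norm ((Q1 ** Ss) ** transpose (Q2 - C))"
      by (metis norm_minus_cancel norm_triangle_ineq4)
    also have "norm ((Q1 - A) ** (Ss ** transpose C)) = norm (Q1 - A)"
      using C sign_matrix_orthogonal[OF Ss(1)]
      by (intro norm_orthogonal_mult_right orthogonal_matrix_mul) (auto simp: orthogonal_matrix_transpose)
    also have "norm ((Q1 ** Ss) ** transpose (Q2 - C)) = norm (Q2 - C)"
      using orthQ sign_matrix_orthogonal[OF Ss(1)]
      by (simp add: norm_orthogonal_mult_left orthogonal_matrix_mul norm_matrix_transpose)
    finally have "norm (Qh1 ** St ** transpose Qh2 - transpose Pt) \<le> \<theta> / K + \<theta> / K"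
      using near1 near2 orth unfolding A_def C_def
      by (simp add: norm_orthogonal_mult_left norm_orthogonal_mult_right orthogonal_matrix_transpose)
    \<comment> \<open>The threshold on \<open>\<theta>\<close> yields
      \<open>\<theta> < 1 / 4\<close>, so the two eigenbasis errors together stay below the margin
      required by the assignment lemma.\<close>
    also have "\<dots> < 1 / 2"
    proof -
      have "1 / (4 * sqrt K) \<le> 1 / 4" using K by (simp add: field_simps)
      then have "\<theta> < 1 / 4" using theta unfolding K_def by linarith
      moreover have "\<theta> / K \<le> \<theta>" using K pos by (simp add: field_simps)
      ultimately show ?thesis by linarith
    qed
    finally show "\<bar>(Qh1 ** St ** transpose Qh2) $ i $ j - transpose Pt $ i $ j\<bar> < 1 / 2" for i j
      using norm_entry_le_matrix[of "Qh1 ** St ** transpose Qh2 - transpose Pt" i j] by simp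
  qed
  moreover have "Ph = Pt" using Ph LAP \<open>Sh = St\<close> by simp
  moreover have "norm (Bh2 - Pt ** Bh1 ** transpose Pt)
      \<le> norm (B1 - P1 ** Bh1 ** transpose P1) + norm (B2 - P2 ** Bh2 ** transpose P2)"
  proof -
    have orth: "orthogonal_matrix P2" "orthogonal_matrix Ps"
      using P12 Ps(1) by (auto intro: perm_matrix_orthogonal)
    \<comment> \<open>Conjugation by \<open>P2\<close> preserves the norm and turns
      \<open>Pt\<close> into \<open>Ps ** P1\<close>. Since \<open>B2\<close> is \<open>B1\<close>
      conjugated by \<open>Ps\<close>, these exact parts cancel and only the two estimation errors
      remain.\<close>
    have "P2 ** (Pt ** Bh1 ** transpose Pt) ** transpose P2
        = (P2 ** transpose P2) ** Ps ** (P1 ** Bh1 ** transpose P1) ** transpose Ps ** (P2 ** transpose P2)"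
      by (simp add: Pt matrix_transpose_mul matrix_mul_assoc)
    also have "\<dots> = Ps ** (P1 ** Bh1 ** transpose P1) ** transpose Ps"
      using orth by (simp add: orthogonal_matrix_def)
    finally have "P2 ** (Bh2 - Pt ** Bh1 ** transpose Pt) ** transpose P2
        = Ps ** (B1 - P1 ** Bh1 ** transpose P1) ** transpose Ps - (B2 - P2 ** Bh2 ** transpose P2)"
      by (simp add: matrix_diff_ldistrib matrix_diff_rdistrib Ps(2))
    then have "norm (P2 ** (Bh2 - Pt ** Bh1 ** transpose Pt) ** transpose P2)
        \<le> norm (Ps ** (B1 - P1 ** Bh1 ** transpose P1) ** transpose Ps) + norm (B2 - P2 ** Bh2 ** transpose P2)"
      by (simp add: norm_triangle_ineq4)
    then show ?thesis
      using orth by (simp add: norm_orthogonal_mult_left norm_orthogonal_mult_right orthogonal_matrix_transpose)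
  qed
  ultimately show ?thesis by blast
qed

end
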